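(* Let $V$ be any variety of algebras (in the sense of universal algebra) and $X$ a finite object of $V$. Then the following conditions are equivalent: (i) $X$ is Rhodes-prime with respect to direct products in the category of finite objects of $V$. (ii) If $Y_0$ and $Y_1$ are finite nonempty objects of $V$ such that $X\in\mathrm{Var}(\{Y_0,Y_1\})$, then $X$ is a subquotient either of $Y_0$ or of $Y_1$. (iii) $\mathrm{Var}(X)$ is join-prime in the join-semilattice of subvarieties of $V$ generated by finite families of finite algebras; and whenever $Y$ is a finite nonempty algebra in $V$ such that $\mathrm{Var}(X)\subseteq\mathrm{Var}(Y)$, $X$ is a subquotient of $Y$.
   Context: The variety $V$ is allowed to have infinitely many operations and/or operations of infinite arities. Every variety with no zeroary operations is understood to contain an empty algebra. For an object or family of objects $X$ of $V$, $\mathrm{Var}(X)$ denotes the subvariety of $V$ generated by $X$. An algebra $X$ is a subquotient of an algebra $Y$ if $X$ is isomorphic to a homomorphic image of a subalgebra of $Y$. A finite algebra $X$ in $V$ is Rhodes-prime with respect to direct products in the category of finite objects of $V$ if, whenever $X$ is a subquotient of a direct product $Y_0\times Y_1$ of finite objects of $V$, then $X$ is a subquotient of one of $Y_0$ or $Y_1$; here one-element algebras and (if it exists in $V$) the empty algebra are not excluded from being called Rhodes-prime. An element $x$ of a lattice (or join-semilattice) is join-prime if $x\le y\vee z$ implies $x\le y$ or $x\le z$. *)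

theory Defs
  imports "HOL-Algebra.Lattice"
begin

text \<open>
  A signature: a set of operation symbols, each with a (possibly empty, possibly infinite) set of
  argument places. Constants are the symbols of empty arity.
\<close>

record ('f, 'i) signature =
  symbols :: "'f set"
  arity :: "'f \<Rightarrow> 'i set"

text \<open>
  An \<open>f\<close>-operation acts on families in \<open>arity S f \<rightarrow>\<^sub>E carrier A\<close>, i.e. on functions that
  are \<open>undefined\<close> outside the arity. The carrier may be empty; by the closure condition this
  happens only if there are no constants.
\<close>

record ('u, 'f, 'i) ualg = "'u partial_object" +
  interp :: "'f \<Rightarrow> ('i \<Rightarrow> 'u) \<Rightarrow> 'u"

definition is_alg :: "('f, 'i) signature \<Rightarrow> ('u, 'f, 'i) ualg \<Rightarrow> bool" where
  "is_alg S A \<longleftrightarrow>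
     (\<forall>f \<in> symbols S. interp A f \<in> (arity S f \<rightarrow>\<^sub>E carrier A) \<rightarrow> carrier A)"

definition alg_hom ::
  "('f, 'i) signature \<Rightarrow> ('u, 'f, 'i) ualg \<Rightarrow> ('w, 'f, 'i) ualg \<Rightarrow> ('u \<Rightarrow> 'w) set" where
  "alg_hom S A B = {h \<in> carrier A \<rightarrow> carrier B.
     \<forall>f \<in> symbols S. \<forall>x \<in> arity S f \<rightarrow>\<^sub>E carrier A.
       h (interp A f x) = interp B f (\<lambda>i \<in> arity S f. h (x i))}"

definition alg_isomorphic ::
  "('f, 'i) signature \<Rightarrow> ('u, 'f, 'i) ualg \<Rightarrow> ('w, 'f, 'i) ualg \<Rightarrow> bool" where
  "alg_isomorphic S A B \<longleftrightarrow> (\<exists>h \<in> alg_hom S A B. bij_betw h (carrier A) (carrier B))"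

definition subalgebra :: "('f, 'i) signature \<Rightarrow> ('u, 'f, 'i) ualg \<Rightarrow> ('u, 'f, 'i) ualg \<Rightarrow> bool" where
  "subalgebra S B A \<longleftrightarrow> is_alg S B \<and> carrier B \<subseteq> carrier A \<and>
     (\<forall>f \<in> symbols S. \<forall>x \<in> arity S f \<rightarrow>\<^sub>E carrier B. interp B f x = interp A f x)"

definition hom_image :: "('f, 'i) signature \<Rightarrow> ('u, 'f, 'i) ualg \<Rightarrow> ('w, 'f, 'i) ualg \<Rightarrow> bool" where
  "hom_image S B A \<longleftrightarrow> is_alg S B \<and> (\<exists>h \<in> alg_hom S A B. h ` carrier A = carrier B)"

definition subquotient ::
  "('f, 'i) signature \<Rightarrow> ('u, 'f, 'i) ualg \<Rightarrow> ('w, 'f, 'i) ualg \<Rightarrow> bool" where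
  "subquotient S X Y \<longleftrightarrow>
     (\<exists>B (Z :: ('u, 'f, 'i) ualg). subalgebra S B Y \<and> hom_image S Z B \<and> alg_isomorphic S X Z)"

definition alg_prod ::
  "('f, 'i) signature \<Rightarrow> ('u, 'f, 'i) ualg \<Rightarrow> ('w, 'f, 'i) ualg \<Rightarrow> ('u \<times> 'w, 'f, 'i) ualg" where
  "alg_prod S A B = \<lparr>carrier = carrier A \<times> carrier B,
     interp = \<lambda>f x. (interp A f (\<lambda>i \<in> arity S f. fst (x i)),
                     interp B f (\<lambda>i \<in> arity S f. snd (x i)))\<rparr>"

text \<open>
  Infinitary terms are well-founded trees. The values of \<open>ts\<close> outside the arity of \<open>f\<close>
  in \<open>App f ts\<close> are irrelevant.
\<close>

datatype ('f, 'i, 'v) trm = Var 'v | App 'f "'i \<Rightarrow> ('f, 'i, 'v) trm"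

inductive_set terms :: "('f, 'i) signature \<Rightarrow> ('f, 'i, 'v) trm set"
  for S :: "('f, 'i) signature" where
  Var: "Var x \<in> terms S"
| App: "f \<in> symbols S \<Longrightarrow> (\<And>i. i \<in> arity S f \<Longrightarrow> ts i \<in> terms S) \<Longrightarrow> App f ts \<in> terms S"

primrec trm_value ::
  "('f, 'i) signature \<Rightarrow> ('u, 'f, 'i) ualg \<Rightarrow> ('v \<Rightarrow> 'u) \<Rightarrow> ('f, 'i, 'v) trm \<Rightarrow> 'u" where
  "trm_value S A v (Var x) = v x"
| "trm_value S A v (App f ts) = interp A f (\<lambda>i \<in> arity S f. trm_value S A v (ts i))"

definition satisfies ::
  "('f, 'i) signature \<Rightarrow> ('u, 'f, 'i) ualg \<Rightarrow> ('f, 'i, 'v) trm \<times> ('f, 'i, 'v) trm \<Rightarrow> bool" where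
  "satisfies S A e \<longleftrightarrow>
     (\<forall>v. range v \<subseteq> carrier A \<longrightarrow> trm_value S A v (fst e) = trm_value S A v (snd e))"

text \<open>
  A variety is the class of all algebras that satisfy a given set of identities. The type \<open>'u\<close>
  serves as the universe in which underlying sets live. A term has at most as many nodes as there
  are finite sequences over \<open>'i\<close>, so every identity can be written with variables from the
  infinite type \<open>'i + nat\<close>, and fixing this type of variables is no restriction.
  If there are no constants, the empty algebra satisfies all identities vacuously and so
  belongs to every variety.
\<close>

definition variety :: "('f, 'i) signature \<Rightarrow> ('u, 'f, 'i) ualg set \<Rightarrow> bool" where
  "variety S V \<longleftrightarrow>
     (\<exists>E :: (('f, 'i, 'i + nat) trm \<times> ('f, 'i, 'i + nat) trm) set.
        E \<subseteq> terms S \<times> terms S \<and> V = {A. is_alg S A \<and> (\<forall>e \<in> E. satisfies S A e)})"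

definition subvariety ::
  "('f, 'i) signature \<Rightarrow> ('u, 'f, 'i) ualg set \<Rightarrow> ('u, 'f, 'i) ualg set \<Rightarrow> bool" where
  "subvariety S V W \<longleftrightarrow> variety S W \<and> W \<subseteq> V"

definition generated_subvariety ::
  "('f, 'i) signature \<Rightarrow> ('u, 'f, 'i) ualg set \<Rightarrow> ('u, 'f, 'i) ualg set \<Rightarrow> ('u, 'f, 'i) ualg set"
  where
  "generated_subvariety S V K = \<Inter>{W. subvariety S V W \<and> K \<subseteq> W}"

definition finite_objects :: "('u, 'f, 'i) ualg set \<Rightarrow> ('u, 'f, 'i) ualg set" where
  "finite_objects V = {A \<in> V. finite (carrier A)}"

definition rhodes_prime ::
  "('f, 'i) signature \<Rightarrow> ('u, 'f, 'i) ualg set \<Rightarrow> ('u, 'f, 'i) ualg \<Rightarrow> bool" where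
  "rhodes_prime S V X \<longleftrightarrow> X \<in> finite_objects V \<and>
     (\<forall>Y0 \<in> finite_objects V. \<forall>Y1 \<in> finite_objects V.
        subquotient S X (alg_prod S Y0 Y1) \<longrightarrow> subquotient S X Y0 \<or> subquotient S X Y1)"

definition finitely_generated_subvarieties ::
  "('f, 'i) signature \<Rightarrow> ('u, 'f, 'i) ualg set \<Rightarrow> ('u, 'f, 'i) ualg set gorder" where
  "finitely_generated_subvarieties S V =
     \<lparr>carrier = {generated_subvariety S V K | K. finite K \<and> K \<subseteq> finite_objects V},
      eq = (=), le = (\<subseteq>)\<rparr>"

definition join_prime :: "('a, 'b) gorder_scheme \<Rightarrow> 'a \<Rightarrow> bool" where
  "join_prime L x \<longleftrightarrow> x \<in> carrier L \<and>
     (\<forall>y \<in> carrier L. \<forall>z \<in> carrier L. x \<sqsubseteq>\<^bsub>L\<^esub> y \<squnion>\<^bsub>L\<^esub> z \<longrightarrow> x \<sqsubseteq>\<^bsub>L\<^esub> y \<or> x \<sqsubseteq>\<^bsub>L\<^esub> z)"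

text \<open>The joins in this order exist; \<open>K \<union> K'\<close> generates the join of the subvarieties
  generated by \<open>K\<close> and \<open>K'\<close>.\<close>

lemma generated_subvariety_least:
  fixes S :: "('f, 'i) signature" and V K K' :: "('u, 'f, 'i) ualg set"
  defines "L \<equiv> finitely_generated_subvarieties S V"
  assumes "finite K" "K \<subseteq> finite_objects V" "finite K'" "K' \<subseteq> finite_objects V"
  shows "least L (generated_subvariety S V (K \<union> K'))
           (Upper L {generated_subvariety S V K, generated_subvariety S V K'})"
proof -
  have gen: "M \<subseteq> generated_subvariety S V M" for M
    by (auto simp: generated_subvariety_def)
  have min: "generated_subvariety S V M \<subseteq> generated_subvariety S V N"
    if "M \<subseteq> generated_subvariety S V N" for M N
    using that unfolding generated_subvariety_def by blast
  have KK': "generated_subvariety S V (K \<union> K') \<in> carrier L"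
    using assms by (auto simp: L_def finitely_generated_subvarieties_def)
  show ?thesis
  proof (rule least_UpperI)
    fix x
    assume "x \<in> {generated_subvariety S V K, generated_subvariety S V K'}"
    then show "x \<sqsubseteq>\<^bsub>L\<^esub> generated_subvariety S V (K \<union> K')"
      using min[of K "K \<union> K'"] min[of K' "K \<union> K'"] gen[of "K \<union> K'"]
      by (auto simp: L_def finitely_generated_subvarieties_def)
  next
    fix y
    assume y: "y \<in> Upper L {generated_subvariety S V K, generated_subvariety S V K'}"
    then obtain N where N: "y = generated_subvariety S V N"
      by (auto simp: Upper_def L_def finitely_generated_subvarieties_def)
    have "generated_subvariety S V K \<subseteq> y" "generated_subvariety S V K' \<subseteq> y"
      using y assms by (auto simp: Upper_def L_def finitely_generated_subvarieties_def)
    then show "generated_subvariety S V (K \<union> K') \<sqsubseteq>\<^bsub>L\<^esub> y"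
      using gen[of K] gen[of K'] min[of "K \<union> K'" N] N
      by (auto simp: L_def finitely_generated_subvarieties_def)
  next
    show "{generated_subvariety S V K, generated_subvariety S V K'} \<subseteq> carrier L"
      using assms by (auto simp: L_def finitely_generated_subvarieties_def)
  qed (fact KK')
qed

end

theory Submission
  imports Defs "HOL-Library.Countable_Set"
begin

text \<open>
  The bridge between \<open>Var\<close> and subquotients is a finitary form of Birkhoff's argument. Let
  \<open>X\<close> be a finite nonempty algebra in the variety generated by a finite set \<open>K\<close> of finite
  algebras, and let \<open>g\<close> be a valuation of the variables whose range is all of \<open>X\<close>. There are
  only finitely many valuations of the form \<open>u \<circ> g\<close> with \<open>u\<close> a map from \<open>X\<close> into a member of
  \<open>K\<close>, whatever the arities are; and if two terms have equal values under all of them, then,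
  after the variables with equal \<open>g\<close>-value are merged, they form an identity of \<open>K\<close>, hence of
  \<open>X\<close>, and so have equal values under \<open>g\<close> (\<open>separation_by_factored_valuations\<close>). Consequently
  \<open>X\<close> is an image of the subalgebra that the family of these valuations generates in the
  corresponding finite product.

  That finite product need not be formed. Two algebras with valuations can be replaced by their
  binary product with the paired valuation, without losing the separation of terms; when only
  one algebra is left, \<open>X\<close> is a subquotient of it (\<open>subquotient_if_separated\<close>), and if \<open>X\<close> is
  Rhodes-prime the binary products can be undone one at a time
  (\<open>rhodes_prime_subquotient_if_separated\<close>). So a Rhodes-prime \<open>X\<close> in \<open>Var K\<close> is a
  subquotient of a member of \<open>K\<close>, as soon as \<open>K\<close> has a nonempty member
  (\<open>rhodes_prime_subquotient_of_generator\<close>). This gives (ii) and (iii). If all members of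
  \<open>K\<close> are empty, every identity holds in \<open>K\<close>, so the algebras in \<open>Var K\<close> lie in every
  subvariety, and join-primality costs nothing.

  Conversely, varieties are closed under subquotients of products, which gives (i) from (ii),
  and the join of \<open>Var Y0\<close> and \<open>Var Y1\<close> is \<open>Var {Y0, Y1}\<close>, which gives (ii) from (iii). A
  product with an empty factor has at most the empty algebra as a subquotient, and the empty
  algebra is a subalgebra of everything.
\<close>

section \<open>Homomorphisms, subalgebras and term values\<close>

lemma restrict_in_PiE:
  assumes "x \<in> I \<rightarrow>\<^sub>E A" "h \<in> A \<rightarrow> B"
  shows "(\<lambda>i \<in> I. h (x i)) \<in> I \<rightarrow>\<^sub>E B"
  using assms by (auto simp: PiE_iff Pi_iff)

lemma interp_closed:
  assumes "is_alg S A" "f \<in> symbols S" "x \<in> arity S f \<rightarrow>\<^sub>E carrier A"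
  shows "interp A f x \<in> carrier A"
  using assms unfolding is_alg_def by blast

lemma alg_hom_interp:
  assumes "h \<in> alg_hom S A B" "f \<in> symbols S" "x \<in> arity S f \<rightarrow>\<^sub>E carrier A"
  shows "h (interp A f x) = interp B f (\<lambda>i \<in> arity S f. h (x i))"
  using assms unfolding alg_hom_def by blast

lemma alg_hom_funcset: "h \<in> alg_hom S A B \<Longrightarrow> h \<in> carrier A \<rightarrow> carrier B"
  unfolding alg_hom_def by blast

lemma alg_hom_comp:
  assumes "h \<in> alg_hom S A B" "k \<in> alg_hom S B C"
  shows "k \<circ> h \<in> alg_hom S A C"
proof -
  have "(k \<circ> h) (interp A f x) = interp C f (\<lambda>i \<in> arity S f. (k \<circ> h) (x i))"
    if f: "f \<in> symbols S" and x: "x \<in> arity S f \<rightarrow>\<^sub>E carrier A" for f x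
  proof -
    have hx: "(\<lambda>i \<in> arity S f. h (x i)) \<in> arity S f \<rightarrow>\<^sub>E carrier B"
      using restrict_in_PiE[OF x alg_hom_funcset[OF assms(1)]] .
    show ?thesis
      using alg_hom_interp[OF assms(1) f x] alg_hom_interp[OF assms(2) f hx]
      by (simp cong: restrict_cong)
  qed
  then show ?thesis
    using alg_hom_funcset[OF assms(1)] alg_hom_funcset[OF assms(2)]
    unfolding alg_hom_def by auto
qed

lemma subalgebra_inclusion_hom:
  assumes "subalgebra S B A"
  shows "id \<in> alg_hom S B A"
proof -
  have "interp B f x = interp A f (\<lambda>i \<in> arity S f. x i)"
    if "f \<in> symbols S" and "x \<in> arity S f \<rightarrow>\<^sub>E carrier B" for f x
    using assms that unfolding subalgebra_def by (metis PiE_restrict)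
  then show ?thesis
    using assms unfolding alg_hom_def subalgebra_def by auto
qed

lemma alg_hom_inv_into:
  assumes A: "is_alg S A" and h: "h \<in> alg_hom S A B" and bij: "bij_betw h (carrier A) (carrier B)"
  shows "inv_into (carrier A) h \<in> alg_hom S B A"
proof -
  let ?k = "inv_into (carrier A) h"
  have k: "?k \<in> carrier B \<rightarrow> carrier A"
    using bij by (metis bij_betw_def bij_betw_inv_into Pi_I image_eqI)
  have "?k (interp B f x) = interp A f (\<lambda>i \<in> arity S f. ?k (x i))"
    if f: "f \<in> symbols S" and x: "x \<in> arity S f \<rightarrow>\<^sub>E carrier B" for f x
  proof -
    let ?y = "\<lambda>i \<in> arity S f. ?k (x i)"
    have y: "?y \<in> arity S f \<rightarrow>\<^sub>E carrier A"
      using restrict_in_PiE[OF x k] .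
    have "(\<lambda>i \<in> arity S f. h (?y i)) = x"
    proof
      fix i
      show "(\<lambda>i \<in> arity S f. h (?y i)) i = x i"
        using x bij by (auto simp: PiE_iff extensional_def bij_betw_inv_into_right)
    qed
    then have "h (interp A f ?y) = interp B f x"
      using alg_hom_interp[OF h f y] by simp
    moreover have "interp A f ?y \<in> carrier A"
      using interp_closed[OF A f y] .
    ultimately show ?thesis
      using bij by (metis bij_betw_inv_into_left)
  qed
  then show ?thesis
    using k unfolding alg_hom_def by blast
qed

lemma trm_value_closed:
  assumes "is_alg S A" "range v \<subseteq> carrier A" "t \<in> terms S"
  shows "trm_value S A v t \<in> carrier A"
  using assms(3)
proof induction
  case (Var x)
  then show ?case using assms(2) by auto
next
  case (App f ts)
  then show ?case by (auto intro!: interp_closed[OF assms(1)])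
qed

lemma trm_value_hom:
  assumes "h \<in> alg_hom S A B" "is_alg S A" "range v \<subseteq> carrier A" "t \<in> terms S"
  shows "trm_value S B (h \<circ> v) t = h (trm_value S A v t)"
  using assms(4)
proof induction
  case (Var x)
  then show ?case by simp
next
  case (App f ts)
  have "(\<lambda>i \<in> arity S f. trm_value S A v (ts i)) \<in> arity S f \<rightarrow>\<^sub>E carrier A"
    using App by (auto intro: trm_value_closed[OF assms(2,3)])
  from alg_hom_interp[OF assms(1) App(1) this] show ?case
    using App by (simp cong: restrict_cong)
qed

lemma trm_value_prod:
  "trm_value S (alg_prod S A B) v t =
     (trm_value S A (fst \<circ> v) t, trm_value S B (snd \<circ> v) t)"
  by (induction t) (simp_all add: alg_prod_def cong: restrict_cong)

lemma trm_value_rename: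
  "trm_value S A v (map_trm id r t) = trm_value S A (v \<circ> r) t"
  by (induction t) (simp_all cong: restrict_cong)

lemma rename_terms: "t \<in> terms S \<Longrightarrow> map_trm id r t \<in> terms S"
  by (induction rule: terms.induct) (auto intro: terms.intros)

lemma is_alg_prod:
  assumes "is_alg S A" "is_alg S B"
  shows "is_alg S (alg_prod S A B)"
proof -
  have "(\<lambda>i \<in> arity S f. fst (x i)) \<in> arity S f \<rightarrow>\<^sub>E carrier A"
       "(\<lambda>i \<in> arity S f. snd (x i)) \<in> arity S f \<rightarrow>\<^sub>E carrier B"
    if "x \<in> arity S f \<rightarrow>\<^sub>E carrier A \<times> carrier B" for f x
    using that by (auto simp: PiE_iff mem_Times_iff)
  then show ?thesis
    using interp_closed[OF assms(1)] interp_closed[OF assms(2)]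
    by (simp add: is_alg_def alg_prod_def)
qed

section \<open>Subquotients\<close>

lemma subquotient_iff:
  fixes X :: "('u, 'f, 'i) ualg"
  assumes "is_alg S X"
  shows "subquotient S X Y \<longleftrightarrow>
    (\<exists>B. subalgebra S B Y \<and> (\<exists>h \<in> alg_hom S B X. h ` carrier B = carrier X))"
proof
  assume "subquotient S X Y"
  then obtain B and Z :: "('u, 'f, 'i) ualg" and h k where
    B: "subalgebra S B Y" and h: "h \<in> alg_hom S B Z" "h ` carrier B = carrier Z"
    and k: "k \<in> alg_hom S X Z" "bij_betw k (carrier X) (carrier Z)"
    unfolding subquotient_def hom_image_def alg_isomorphic_def by blast
  let ?k' = "inv_into (carrier X) k"
  have "?k' \<circ> h \<in> alg_hom S B X"
    using alg_hom_comp[OF h(1) alg_hom_inv_into[OF assms k]] .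
  moreover have "(?k' \<circ> h) ` carrier B = carrier X"
    using h(2) k(2) by (metis bij_betw_def bij_betw_inv_into image_comp)
  ultimately show "\<exists>B. subalgebra S B Y \<and> (\<exists>h \<in> alg_hom S B X. h ` carrier B = carrier X)"
    using B by blast
next
  assume "\<exists>B. subalgebra S B Y \<and> (\<exists>h \<in> alg_hom S B X. h ` carrier B = carrier X)"
  moreover have "alg_isomorphic S X X"
  proof -
    have "id \<in> alg_hom S X X"
      using assms by (auto intro: subalgebra_inclusion_hom simp: subalgebra_def)
    then show ?thesis
      unfolding alg_isomorphic_def using bij_betw_id by blast
  qed
  ultimately show "subquotient S X Y"
    using assms unfolding subquotient_def hom_image_def by blast
qed

lemma subquotientE:
  assumes "subquotient S X Y" "is_alg S X"
  obtains B h where "subalgebra S B Y" "h \<in> alg_hom S B X" "h ` carrier B = carrier X"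
proof -
  from assms have "\<exists>B. subalgebra S B Y \<and> (\<exists>h \<in> alg_hom S B X. h ` carrier B = carrier X)"
    by (simp add: subquotient_iff)
  then show ?thesis
    by (elim exE conjE bexE) (rule that)
qed

lemma subquotient_trans:
  assumes X: "is_alg S X" and Y: "is_alg S Y" and Z: "is_alg S Z"
    and "subquotient S X Y" "subquotient S Y Z"
  shows "subquotient S X Z"
proof -
  obtain B h where B: "subalgebra S B Y" and h: "h \<in> alg_hom S B X" "h ` carrier B = carrier X"
    using assms(4) X by (rule subquotientE)
  obtain C k where C: "subalgebra S C Z" and k: "k \<in> alg_hom S C Y" "k ` carrier C = carrier Y"
    using assms(5) Y by (rule subquotientE)
  define D where "D = C\<lparr>carrier := {c \<in> carrier C. k c \<in> carrier B}\<rparr>"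
  have carrier_D: "carrier D = {c \<in> carrier C. k c \<in> carrier B}" "interp D = interp C"
    by (simp_all add: D_def)
  have C_alg: "is_alg S C" and B_alg: "is_alg S B"
    using B C by (auto simp: subalgebra_def)
  have k_interp: "k (interp C f x) = interp B f (\<lambda>i \<in> arity S f. k (x i))"
    and kx: "(\<lambda>i \<in> arity S f. k (x i)) \<in> arity S f \<rightarrow>\<^sub>E carrier B"
    and x_C: "x \<in> arity S f \<rightarrow>\<^sub>E carrier C"
    if f: "f \<in> symbols S" and x: "x \<in> arity S f \<rightarrow>\<^sub>E carrier D" for f x
  proof -
    show x_C: "x \<in> arity S f \<rightarrow>\<^sub>E carrier C" and kx: "(\<lambda>i \<in> arity S f. k (x i)) \<in> arity S f \<rightarrow>\<^sub>E carrier B"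
      using x by (auto simp: carrier_D PiE_iff)
    then show "k (interp C f x) = interp B f (\<lambda>i \<in> arity S f. k (x i))"
      using alg_hom_interp[OF k(1) f x_C] B f by (simp add: subalgebra_def)
  qed
  have D_alg: "is_alg S D"
    using k_interp kx x_C interp_closed[OF C_alg] interp_closed[OF B_alg]
    unfolding is_alg_def by (auto simp: carrier_D)
  then have "subalgebra S D Z"
    using C x_C unfolding subalgebra_def by (auto simp: carrier_D)
  moreover have "k \<in> alg_hom S D B"
    using k_interp unfolding alg_hom_def by (auto simp: carrier_D)
  then have "h \<circ> k \<in> alg_hom S D X"
    using alg_hom_comp h(1) by blast
  moreover have "(h \<circ> k) ` carrier D = carrier X"
  proof -
    have "k ` carrier D = carrier B"
      using k(2) B by (auto simp: carrier_D subalgebra_def)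
    then show ?thesis
      using h(2) by (metis image_comp)
  qed
  ultimately show ?thesis
    using subquotient_iff[OF X] by blast
qed

text \<open>Because the empty set carries an algebra, every operation has an argument place, and so
  is never applied to elements of the empty set.\<close>

lemma empty_subquotient:
  assumes "is_alg S X" "carrier X = {}"
  shows "subquotient S X Y"
proof -
  define B where "B = Y\<lparr>carrier := {}\<rparr>"
  have "arity S f \<noteq> {}" if "f \<in> symbols S" for f
    using assms that by (force simp: is_alg_def)
  then have no_args: "arity S f \<rightarrow>\<^sub>E {} = {}" if "f \<in> symbols S" for f
    using that by (auto simp: PiE_eq_empty_iff)
  then have "subalgebra S B Y"
    by (auto simp: subalgebra_def is_alg_def B_def)
  moreover have "(\<lambda>_. undefined) \<in> alg_hom S B X"
    using no_args by (auto simp: alg_hom_def B_def)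
  moreover have "(\<lambda>_. undefined) ` carrier B = carrier X"
    using assms(2) by (simp add: B_def)
  ultimately show ?thesis
    using subquotient_iff[OF assms(1)] by blast
qed

text \<open>Transport of structure: the universe is only assumed to be infinite, so a product of two
  finite algebras becomes an object of the variety only after its elements are renamed.\<close>

lemma isomorphic_copy:
  fixes A :: "('a, 'f, 'i) ualg"
  assumes "infinite (UNIV :: 'u set)" "is_alg S A" "finite (carrier A)"
  obtains C :: "('u, 'f, 'i) ualg" and h where
    "is_alg S C" "finite (carrier C)" "h \<in> alg_hom S A C" "bij_betw h (carrier A) (carrier C)"
proof -
  obtain h :: "'a \<Rightarrow> 'u" where inj: "inj_on h (carrier A)"
  proof -
    obtain T :: "'u set" where "finite T" "card T = card (carrier A)"
      using infinite_arbitrarily_large[OF assms(1)] by blast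
    then show ?thesis
      using that assms(3) finite_same_card_bij by (metis bij_betw_imp_inj_on)
  qed
  let ?k = "inv_into (carrier A) h"
  define C :: "('u, 'f, 'i) ualg" where
    "C = \<lparr>carrier = h ` carrier A,
          interp = \<lambda>f x. h (interp A f (\<lambda>i \<in> arity S f. ?k (x i)))\<rparr>"
  have "h (interp A f x) = interp C f (\<lambda>i \<in> arity S f. h (x i))"
    if x: "x \<in> arity S f \<rightarrow>\<^sub>E carrier A" for f x
  proof -
    have "(\<lambda>i \<in> arity S f. ?k ((\<lambda>i \<in> arity S f. h (x i)) i)) = x"
    proof
      fix i
      show "(\<lambda>i \<in> arity S f. ?k ((\<lambda>i \<in> arity S f. h (x i)) i)) i = x i"
        using x inj by (auto simp: PiE_iff extensional_def)
    qed
    then show ?thesis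
      by (simp add: C_def)
  qed
  then have hom: "h \<in> alg_hom S A C"
    by (auto simp: alg_hom_def C_def)
  have alg: "is_alg S C"
  proof -
    have "?k \<in> h ` carrier A \<rightarrow> carrier A"
      by (auto intro: inv_into_into)
    then show ?thesis
      using interp_closed[OF assms(2) _ restrict_in_PiE] unfolding is_alg_def C_def
      by (auto intro!: imageI)
  qed
  have fin: "finite (carrier C)" and bij: "bij_betw h (carrier A) (carrier C)"
    using assms(3) inj by (auto simp: C_def bij_betw_def)
  show ?thesis
    using that[OF alg fin hom bij] .
qed

section \<open>Identities and generated subvarieties\<close>

lemma satisfies_subquotient:
  assumes X: "is_alg S X" and "subquotient S X Y" and "satisfies S Y e" and e: "e \<in> terms S \<times> terms S"
  shows "satisfies S X e"
proof -
  obtain B h where B: "subalgebra S B Y" and h: "h \<in> alg_hom S B X" "h ` carrier B = carrier X"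
    using assms(2) X by (rule subquotientE)
  have B_alg: "is_alg S B"
    using B by (simp add: subalgebra_def)
  have "trm_value S X v (fst e) = trm_value S X v (snd e)" if v: "range v \<subseteq> carrier X" for v
  proof -
    define v' where "v' = inv_into (carrier B) h \<circ> v"
    have v_image: "v x \<in> h ` carrier B" for x
      using v h(2) by blast
    have v'_B: "range v' \<subseteq> carrier B" and v': "h \<circ> v' = v"
      using inv_into_into[OF v_image] f_inv_into_f[OF v_image] by (auto simp: v'_def)
    have "range v' \<subseteq> carrier Y"
      using v'_B B by (auto simp: subalgebra_def)
    then have "trm_value S Y v' (fst e) = trm_value S Y v' (snd e)"
      using assms(3) by (simp add: satisfies_def)
    then have "trm_value S B v' (fst e) = trm_value S B v' (snd e)"
      using trm_value_hom[OF subalgebra_inclusion_hom[OF B] B_alg v'_B] e by fastforce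
    then show ?thesis
      using trm_value_hom[OF h(1) B_alg v'_B] e unfolding v' by fastforce
  qed
  then show ?thesis
    by (simp add: satisfies_def)
qed

lemma satisfies_prod:
  fixes A :: "('u, 'f, 'i) ualg" and B :: "('w, 'f, 'i) ualg"
    and e :: "('f, 'i, 'v) trm \<times> ('f, 'i, 'v) trm"
  assumes "satisfies S A e" "satisfies S B e"
  shows "satisfies S (alg_prod S A B) e"
  unfolding satisfies_def
proof (intro allI impI)
  fix v :: "'v \<Rightarrow> 'u \<times> 'w"
  assume "range v \<subseteq> carrier (alg_prod S A B)"
  then have "range (fst \<circ> v) \<subseteq> carrier A" "range (snd \<circ> v) \<subseteq> carrier B"
    by (auto simp: alg_prod_def image_subset_iff mem_Times_iff)
  then show "trm_value S (alg_prod S A B) v (fst e) = trm_value S (alg_prod S A B) v (snd e)"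
    using assms unfolding satisfies_def trm_value_prod by presburger
qed

lemma variety_is_alg: "variety S V \<Longrightarrow> A \<in> V \<Longrightarrow> is_alg S A"
  unfolding variety_def by auto

lemma variety_subquotient_prod:
  fixes S :: "('f, 'i) signature"
  assumes V: "variety S V" and Y: "Y0 \<in> V" "Y1 \<in> V"
    and X: "is_alg S X" "subquotient S X (alg_prod S Y0 Y1)"
  shows "X \<in> V"
proof -
  obtain E :: "(('f, 'i, 'i + nat) trm \<times> ('f, 'i, 'i + nat) trm) set"
    where E: "E \<subseteq> terms S \<times> terms S" and V_eq: "V = {A. is_alg S A \<and> (\<forall>e \<in> E. satisfies S A e)}"
    using V unfolding variety_def by blast
  have "satisfies S X e" if "e \<in> E" for e
    using that E Y satisfies_prod[of S Y0 e Y1] satisfies_subquotient[OF X, of e]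
    by (auto simp: V_eq)
  then show ?thesis
    using X(1) by (simp add: V_eq)
qed

text \<open>The Galois connection between algebras and identities: membership in \<open>Var K\<close> can be
  tested on one identity at a time.\<close>

lemma mem_generated_subvariety_iff:
  fixes S :: "('f, 'i) signature" and V K :: "('u, 'f, 'i) ualg set"
  assumes V: "variety S V" and K: "K \<subseteq> V"
  shows "X \<in> generated_subvariety S V K \<longleftrightarrow> X \<in> V \<and>
    (\<forall>t \<in> terms S. \<forall>s :: ('f, 'i, 'i + nat) trm \<in> terms S.
       (\<forall>Y \<in> K. satisfies S Y (t, s)) \<longrightarrow> satisfies S X (t, s))"
    (is "_ \<longleftrightarrow> X \<in> V \<and> ?ids")
proof
  assume X: "X \<in> generated_subvariety S V K"
  have "X \<in> V"
    using X V K unfolding generated_subvariety_def subvariety_def by blast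
  moreover have ?ids
  proof (intro ballI impI)
    fix t s :: "('f, 'i, 'i + nat) trm"
    assume ts: "t \<in> terms S" "s \<in> terms S" and sat: "\<forall>Y \<in> K. satisfies S Y (t, s)"
    obtain E :: "(('f, 'i, 'i + nat) trm \<times> ('f, 'i, 'i + nat) trm) set"
      where E: "E \<subseteq> terms S \<times> terms S" and V_eq: "V = {A. is_alg S A \<and> (\<forall>e \<in> E. satisfies S A e)}"
      using V unfolding variety_def by blast
    define W where "W = {A :: ('u, 'f, 'i) ualg. is_alg S A \<and> (\<forall>e \<in> insert (t, s) E. satisfies S A e)}"
    have "insert (t, s) E \<subseteq> terms S \<times> terms S"
      using E ts by auto
    then have "variety S W"
      unfolding variety_def W_def by blast
    then have "subvariety S V W"
      by (auto simp: subvariety_def W_def V_eq)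
    moreover have "K \<subseteq> W"
      using K sat by (auto simp: W_def V_eq)
    ultimately have "X \<in> W"
      using X unfolding generated_subvariety_def by blast
    then show "satisfies S X (t, s)"
      by (simp add: W_def)
  qed
  ultimately show "X \<in> V \<and> ?ids" by blast
next
  assume X: "X \<in> V \<and> ?ids"
  have "X \<in> W" if W: "subvariety S V W" "K \<subseteq> W" for W
  proof -
    obtain E :: "(('f, 'i, 'i + nat) trm \<times> ('f, 'i, 'i + nat) trm) set"
      where E: "E \<subseteq> terms S \<times> terms S" and W_eq: "W = {A. is_alg S A \<and> (\<forall>e \<in> E. satisfies S A e)}"
      using W(1) unfolding subvariety_def variety_def by blast
    have "satisfies S X (t, s)" if "(t, s) \<in> E" for t s
    proof -
      have "t \<in> terms S" "s \<in> terms S"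
        using that E by blast+
      moreover have "\<forall>Y \<in> K. satisfies S Y (t, s)"
        using that W(2) unfolding W_eq by blast
      ultimately show ?thesis
        using X by blast
    qed
    then have "\<forall>e \<in> E. satisfies S X e"
      by (metis surj_pair)
    moreover have "is_alg S X"
      using X variety_is_alg[OF V] by blast
    ultimately show ?thesis
      by (simp add: W_eq)
  qed
  then show "X \<in> generated_subvariety S V K"
    unfolding generated_subvariety_def by blast
qed

lemma generated_subvariety_subset_iff:
  "generated_subvariety S V K \<subseteq> generated_subvariety S V L \<longleftrightarrow> K \<subseteq> generated_subvariety S V L"
  unfolding generated_subvariety_def by blast

lemma subquotient_in_generated_subvariety:
  assumes "variety S V" "K \<subseteq> V" "Y \<in> K" "X \<in> V" "subquotient S X Y"
  shows "X \<in> generated_subvariety S V K"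
  using assms(3-5) satisfies_subquotient[OF variety_is_alg[OF assms(1,4)] assms(5)]
  by (auto simp: mem_generated_subvariety_iff[OF assms(1,2)])

text \<open>\<open>join\<close> chooses some least upper bound; in an order with equality as its equivalence there
  is only one.\<close>

lemma join_generated_subvarieties:
  fixes S :: "('f, 'i) signature" and V K K' :: "('u, 'f, 'i) ualg set"
  assumes "finite K" "K \<subseteq> finite_objects V" "finite K'" "K' \<subseteq> finite_objects V"
  defines "L \<equiv> finitely_generated_subvarieties S V"
  shows "generated_subvariety S V K \<squnion>\<^bsub>L\<^esub> generated_subvariety S V K' =
    generated_subvariety S V (K \<union> K')"
proof -
  let ?U = "Upper L {generated_subvariety S V K, generated_subvariety S V K'}"
  have least: "least L (generated_subvariety S V (K \<union> K')) ?U"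
    unfolding L_def by (rule generated_subvariety_least[OF assms(1-4)])
  have some: "least L (SOME x. least L x ?U) ?U"
    by (rule someI[where P = "\<lambda>x. least L x ?U", OF least])
  have le_L: "le L = (\<subseteq>)"
    by (simp add: L_def finitely_generated_subvarieties_def)
  have "(SOME x. least L x ?U) = generated_subvariety S V (K \<union> K')"
    using least_le[OF some least_mem[OF least]] least_le[OF least least_mem[OF some]]
    unfolding le_L by (rule equalityI)
  then show ?thesis
    unfolding join_def sup_def .
qed

section \<open>Separation of terms by valuations\<close>

text \<open>The subalgebra that \<open>v\<close> generates consists of the values of terms under \<open>v\<close>; the
  hypothesis says exactly that sending the value of a term under \<open>v\<close> to its value under \<open>w\<close> is
  well defined.\<close>

lemma subquotient_if_separated:
  fixes v :: "'v \<Rightarrow> 'w" and w :: "'v \<Rightarrow> 'u"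
  assumes X: "is_alg S X" and Y: "is_alg S Y" and v: "range v \<subseteq> carrier Y" and w: "range w = carrier X"
    and sep: "\<And>t s. t \<in> terms S \<Longrightarrow> s \<in> terms S \<Longrightarrow>
      trm_value S Y v t = trm_value S Y v s \<Longrightarrow> trm_value S X w t = trm_value S X w s"
  shows "subquotient S X Y"
proof -
  define B where "B = Y\<lparr>carrier := trm_value S Y v ` terms S\<rparr>"
  have B_simps: "carrier B = trm_value S Y v ` terms S" "interp B = interp Y"
    by (simp_all add: B_def)
  define h where "h b = trm_value S X w (SOME t. t \<in> terms S \<and> trm_value S Y v t = b)" for b
  have h: "h (trm_value S Y v t) = trm_value S X w t" if "t \<in> terms S" for t
  proof -
    have "(SOME s. s \<in> terms S \<and> trm_value S Y v s = trm_value S Y v t) \<in> terms S \<and>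
      trm_value S Y v (SOME s. s \<in> terms S \<and> trm_value S Y v s = trm_value S Y v t) = trm_value S Y v t"
      by (rule someI[of _ t]) (simp add: that)
    then show ?thesis
      unfolding h_def using sep that by blast
  qed
  have args_are_values:
    "\<exists>ts. App f ts \<in> terms S \<and> (\<forall>i \<in> arity S f. ts i \<in> terms S) \<and>
          x = (\<lambda>i \<in> arity S f. trm_value S Y v (ts i))"
    if f: "f \<in> symbols S" and x: "x \<in> arity S f \<rightarrow>\<^sub>E carrier B" for f x
  proof -
    have "\<forall>i \<in> arity S f. \<exists>t. t \<in> terms S \<and> x i = trm_value S Y v t"
      using x by (auto simp: B_simps PiE_iff)
    then obtain ts where ts: "\<And>i. i \<in> arity S f \<Longrightarrow> ts i \<in> terms S \<and> x i = trm_value S Y v (ts i)"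
      by metis
    then have "x = (\<lambda>i \<in> arity S f. trm_value S Y v (ts i))"
      using x by (auto simp: fun_eq_iff PiE_iff extensional_def)
    then show ?thesis
      using ts terms.App[OF f] by blast
  qed
  have "interp Y f x \<in> carrier B"
    if "f \<in> symbols S" and "x \<in> arity S f \<rightarrow>\<^sub>E carrier B" for f x
    using args_are_values[OF that] by (auto simp: B_simps intro: rev_image_eqI)
  then have "is_alg S B"
    by (auto simp: is_alg_def B_simps(2))
  then have "subalgebra S B Y"
    using trm_value_closed[OF Y v] by (auto simp: subalgebra_def B_simps)
  moreover have "h \<in> alg_hom S B X"
  proof -
    have "h (interp B f x) = interp X f (\<lambda>i \<in> arity S f. h (x i))"
      if fx: "f \<in> symbols S" "x \<in> arity S f \<rightarrow>\<^sub>E carrier B" for f x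
    proof -
      obtain ts where ts: "App f ts \<in> terms S" "\<forall>i \<in> arity S f. ts i \<in> terms S"
        "x = (\<lambda>i \<in> arity S f. trm_value S Y v (ts i))"
        using args_are_values[OF fx] by blast
      then have "(\<lambda>i \<in> arity S f. h (x i)) = (\<lambda>i \<in> arity S f. trm_value S X w (ts i))"
        using h by (auto simp: fun_eq_iff)
      then show ?thesis
        using h[OF ts(1)] ts(3) by (simp add: B_simps(2))
    qed
    moreover have "h \<in> carrier B \<rightarrow> carrier X"
      using h trm_value_closed[OF X eq_refl[OF w]] by (auto simp: B_simps(1))
    ultimately show ?thesis
      unfolding alg_hom_def by blast
  qed
  moreover have "h ` carrier B = carrier X"
  proof
    show "h ` carrier B \<subseteq> carrier X"
      using h trm_value_closed[OF X eq_refl[OF w]] by (auto simp: B_simps(1))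
    show "carrier X \<subseteq> h ` carrier B"
    proof
      fix a
      assume "a \<in> carrier X"
      then obtain x where "a = w x"
        using w by blast
      then have "a = h (trm_value S Y v (Var x))"
        using h[OF terms.Var] by simp
      moreover have "trm_value S Y v (Var x) \<in> carrier B"
        unfolding B_simps(1) by (intro imageI terms.Var)
      ultimately show "a \<in> h ` carrier B"
        by blast
    qed
  qed
  ultimately show ?thesis
    using subquotient_iff[OF X] by blast
qed

text \<open>The pairs \<open>(Y, v)\<close> stand for the factors of a finite product with the valuation given by
  all the \<open>v\<close>. The induction merges the first two factors and lets Rhodes-primality separate
  them again, so that only binary products occur.\<close>

lemma rhodes_prime_subquotient_if_separated:
  fixes V :: "('u, 'f, 'i) ualg set" and w :: "'v \<Rightarrow> 'u"
  assumes inf: "infinite (UNIV :: 'u set)" and V: "variety S V" and prime: "rhodes_prime S V X"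
    and w: "range w = carrier X"
    and Ps: "\<And>Y v. (Y, v) \<in> set (p # ps) \<Longrightarrow> Y \<in> finite_objects V \<and> range v \<subseteq> carrier Y"
    and sep: "\<And>t s. t \<in> terms S \<Longrightarrow> s \<in> terms S \<Longrightarrow>
      (\<And>Y v. (Y, v) \<in> set (p # ps) \<Longrightarrow> trm_value S Y v t = trm_value S Y v s) \<Longrightarrow>
      trm_value S X w t = trm_value S X w s"
  shows "\<exists>(Y, v) \<in> set (p # ps). subquotient S X Y"
proof -
  have X: "is_alg S X"
    using prime V by (auto simp: rhodes_prime_def finite_objects_def variety_is_alg)
  from Ps sep show ?thesis
  proof (induction ps arbitrary: p)
    case Nil
    obtain Y v where p: "p = (Y, v)"
      by fastforce
    have "Y \<in> V" "range v \<subseteq> carrier Y"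
      using p Nil.prems(1) by (auto simp: finite_objects_def)
    moreover have "trm_value S X w t = trm_value S X w s"
      if "t \<in> terms S" "s \<in> terms S" "trm_value S Y v t = trm_value S Y v s" for t s
      by (rule Nil.prems(2)[OF that(1,2)]) (use that(3) p in simp)
    ultimately have "subquotient S X Y"
      using subquotient_if_separated[OF X variety_is_alg[OF V] _ w] by blast
    then show ?case
      by (simp add: p)
  next
    case (Cons q ps)
    obtain Y0 v0 Y1 v1 where p: "p = (Y0, v0)" and q: "q = (Y1, v1)"
      by fastforce
    have Y: "Y0 \<in> V" "Y1 \<in> V" "finite (carrier Y0)" "finite (carrier Y1)"
      and v: "range v0 \<subseteq> carrier Y0" "range v1 \<subseteq> carrier Y1"
      using Cons.prems(1)[of Y0 v0] Cons.prems(1)[of Y1 v1] p q by (auto simp: finite_objects_def)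
    define P where "P = alg_prod S Y0 Y1"
    have P: "is_alg S P" "finite (carrier P)"
      using Y is_alg_prod variety_is_alg[OF V] by (auto simp: P_def alg_prod_def)
    obtain C :: "('u, 'f, 'i) ualg" and h where C: "is_alg S C" "finite (carrier C)"
      and h: "h \<in> alg_hom S P C" "bij_betw h (carrier P) (carrier C)"
      using isomorphic_copy[OF inf P] .
    define u where "u x = (v0 x, v1 x)" for x
    have u: "range u \<subseteq> carrier P"
      using v by (auto simp: u_def P_def alg_prod_def)
    have "subalgebra S P P"
      using P by (simp add: subalgebra_def)
    then have C_P: "subquotient S C P"
      using subquotient_iff[OF C(1)] h by (metis bij_betw_def)
    then have C_V: "C \<in> finite_objects V"
      using variety_subquotient_prod[OF V Y(1,2) C(1)] C(2) by (simp add: P_def finite_objects_def)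
    have merged_value:
      "trm_value S Y0 v0 t = trm_value S Y0 v0 s \<and> trm_value S Y1 v1 t = trm_value S Y1 v1 s"
      if ts: "t \<in> terms S" "s \<in> terms S"
        and eq: "trm_value S C (h \<circ> u) t = trm_value S C (h \<circ> u) s" for t s
    proof -
      have "h (trm_value S P u t) = h (trm_value S P u s)"
        using eq trm_value_hom[OF h(1) P(1) u] ts by simp
      then have "trm_value S P u t = trm_value S P u s"
        using h(2) trm_value_closed[OF P(1) u] ts by (auto simp: bij_betw_def inj_on_def)
      then show ?thesis
        by (simp add: P_def trm_value_prod u_def comp_def)
    qed
    have "\<exists>(Y, v) \<in> set ((C, h \<circ> u) # ps). subquotient S X Y"
    proof (rule Cons.IH)
      fix Y v
      assume "(Y, v) \<in> set ((C, h \<circ> u) # ps)"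
      moreover have "range (h \<circ> u) \<subseteq> carrier C"
        using u h(2) by (auto simp: bij_betw_def)
      ultimately show "Y \<in> finite_objects V \<and> range v \<subseteq> carrier Y"
        using C_V Cons.prems(1)[of Y v] by auto
    next
      fix t s :: "('f, 'i, 'v) trm"
      assume ts: "t \<in> terms S" "s \<in> terms S"
        and eq: "\<And>Y v. (Y, v) \<in> set ((C, h \<circ> u) # ps) \<Longrightarrow> trm_value S Y v t = trm_value S Y v s"
      show "trm_value S X w t = trm_value S X w s"
        using merged_value[OF ts] eq by (intro Cons.prems(2)[OF ts]) (auto simp: p q)
    qed
    moreover have "subquotient S X Y0 \<or> subquotient S X Y1" if "subquotient S X C"
    proof -
      have "subquotient S X (alg_prod S Y0 Y1)"
        using subquotient_trans[OF X C(1) P(1) that C_P] by (simp add: P_def)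
      then show ?thesis
        using prime Y by (auto simp: rhodes_prime_def finite_objects_def)
    qed
    ultimately show ?case
      by (auto simp: p q)
  qed
qed

text \<open>Although an identity may involve infinitely many variables, valuations that factor
  through one fixed \<open>g\<close> onto \<open>X\<close> suffice: replacing each variable by a chosen representative of
  its \<open>g\<close>-fibre turns every valuation into such a one, and leaves the value under \<open>g\<close> itself
  unchanged.\<close>

lemma separation_by_factored_valuations:
  fixes S :: "('f, 'i) signature" and t s :: "('f, 'i, 'i + nat) trm"
  assumes V: "variety S V" "K \<subseteq> V" and X: "X \<in> generated_subvariety S V K"
    and g: "range g = carrier X" and ts: "t \<in> terms S" "s \<in> terms S"
    and eq: "\<And>Y u. Y \<in> K \<Longrightarrow> u \<in> carrier X \<rightarrow>\<^sub>E carrier Y \<Longrightarrow>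
      trm_value S Y (u \<circ> g) t = trm_value S Y (u \<circ> g) s"
  shows "trm_value S X g t = trm_value S X g s"
proof -
  let ?r = "inv g \<circ> g"
  have "satisfies S Y (map_trm id ?r t, map_trm id ?r s)" if Y: "Y \<in> K" for Y
  proof -
    have "trm_value S Y (v \<circ> ?r) t = trm_value S Y (v \<circ> ?r) s" if v: "range v \<subseteq> carrier Y" for v
    proof -
      let ?u = "\<lambda>a \<in> carrier X. v (inv g a)"
      have "?u \<in> carrier X \<rightarrow>\<^sub>E carrier Y"
        using v by auto
      moreover have "?u \<circ> g = v \<circ> ?r"
        using g by (auto simp: fun_eq_iff)
      ultimately show ?thesis
        using eq[OF Y] by metis
    qed
    then show ?thesis
      by (simp add: satisfies_def trm_value_rename)
  qed
  then have "satisfies S X (map_trm id ?r t, map_trm id ?r s)"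
    using X ts by (simp add: mem_generated_subvariety_iff[OF V] rename_terms)
  then have "trm_value S X (g \<circ> ?r) t = trm_value S X (g \<circ> ?r) s"
    using g by (simp add: satisfies_def trm_value_rename)
  moreover have "g \<circ> ?r = g"
    by (auto simp: f_inv_into_f)
  ultimately show ?thesis
    by simp
qed

text \<open>Without a nonempty member of \<open>K\<close> the one-element algebras of \<open>V\<close> would be
  counterexamples: they lie in every subvariety, but are not subquotients of the empty
  algebra.\<close>

lemma rhodes_prime_subquotient_of_generator:
  fixes S :: "('f, 'i) signature" and V :: "('u, 'f, 'i) ualg set"
  assumes inf: "infinite (UNIV :: 'u set)" and V: "variety S V" and prime: "rhodes_prime S V X"
    and K: "finite K" "K \<subseteq> finite_objects V" and X_K: "X \<in> generated_subvariety S V K"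
    and nonempty: "\<exists>Y \<in> K. carrier Y \<noteq> {}"
  shows "\<exists>Y \<in> K. subquotient S X Y"
proof -
  have X: "is_alg S X" "finite (carrier X)"
    using prime V by (auto simp: rhodes_prime_def finite_objects_def variety_is_alg)
  have K_V: "K \<subseteq> V"
    using K(2) by (auto simp: finite_objects_def)
  show ?thesis
  proof (cases "carrier X = {}")
    case True
    then show ?thesis
      using empty_subquotient[OF X(1)] nonempty by blast
  next
    case False
    define g :: "'i + nat \<Rightarrow> 'u" where "g = from_nat_into (carrier X) \<circ> case_sum (\<lambda>_. 0) id"
    have "range (case_sum (\<lambda>_. 0) id :: 'i + nat \<Rightarrow> nat) = UNIV"
      by (metis (no_types) id_apply old.sum.simps(6) surjI)
    then have "range g = range (from_nat_into (carrier X))"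
      unfolding g_def by (metis image_comp)
    then have g: "range g = carrier X"
      using range_from_nat_into[OF False countable_finite[OF X(2)]] by simp
    define Q where "Q = (\<lambda>(Y, u). (Y, u \<circ> g)) ` (SIGMA Y : K. carrier X \<rightarrow>\<^sub>E carrier Y)"
    have "finite Q"
      using K X(2) unfolding Q_def
      by (intro finite_imageI finite_SigmaI finite_PiE) (auto simp: finite_objects_def)
    then obtain qs where qs: "set qs = Q"
      using finite_list by blast
    have Q_mem: "(Y, v) \<in> Q \<longleftrightarrow> Y \<in> K \<and> (\<exists>u \<in> carrier X \<rightarrow>\<^sub>E carrier Y. v = u \<circ> g)" for Y v
      by (auto simp: Q_def)
    obtain Y a where "Y \<in> K" "a \<in> carrier Y"
      using nonempty by blast
    then have "(Y, (\<lambda>_ \<in> carrier X. a) \<circ> g) \<in> Q"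
      unfolding Q_mem by auto
    then have "Q \<noteq> {}"
      by blast
    then obtain p ps where "qs = p # ps"
      using qs by (metis list.set(1) neq_Nil_conv)
    then have ps: "set (p # ps) = Q"
      using qs by simp
    have "\<exists>(Y, v) \<in> set (p # ps). subquotient S X Y"
    proof (rule rhodes_prime_subquotient_if_separated[OF inf V prime g])
      fix Y v
      assume "(Y, v) \<in> set (p # ps)"
      then obtain u where "Y \<in> K" "u \<in> carrier X \<rightarrow>\<^sub>E carrier Y" "v = u \<circ> g"
        unfolding ps Q_mem by blast
      then show "Y \<in> finite_objects V \<and> range v \<subseteq> carrier Y"
        using K(2) g by auto
    next
      fix t s :: "('f, 'i, 'i + nat) trm"
      assume ts: "t \<in> terms S" "s \<in> terms S"
        and eq: "\<And>Y v. (Y, v) \<in> set (p # ps) \<Longrightarrow> trm_value S Y v t = trm_value S Y v s"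
      have "trm_value S Y (u \<circ> g) t = trm_value S Y (u \<circ> g) s"
        if "Y \<in> K" "u \<in> carrier X \<rightarrow>\<^sub>E carrier Y" for Y u
        using that by (intro eq) (auto simp only: ps Q_mem)
      then show "trm_value S X g t = trm_value S X g s"
        by (rule separation_by_factored_valuations[OF V K_V X_K g ts])
    qed
    then show ?thesis
      unfolding ps by (auto simp: Q_mem)
  qed
qed

section \<open>The equivalence\<close>

lemma rhodes_prime_imp_join_prime:
  fixes V :: "('u, 'f, 'i) ualg set"
  assumes inf: "infinite (UNIV :: 'u set)" and V: "variety S V" and prime: "rhodes_prime S V X"
  shows "join_prime (finitely_generated_subvarieties S V) (generated_subvariety S V {X})"
proof -
  let ?L = "finitely_generated_subvarieties S V"
  let ?Var = "generated_subvariety S V"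
  have X: "X \<in> V" "X \<in> finite_objects V"
    using prime by (auto simp: rhodes_prime_def finite_objects_def)
  have "?Var {X} \<subseteq> ?Var K \<or> ?Var {X} \<subseteq> ?Var K'"
    if K: "finite K" "K \<subseteq> finite_objects V" and K': "finite K'" "K' \<subseteq> finite_objects V"
      and le: "?Var {X} \<subseteq> ?Var K \<squnion>\<^bsub>?L\<^esub> ?Var K'" for K K'
  proof -
    have X_KK': "X \<in> ?Var (K \<union> K')"
      using le by (simp add: join_generated_subvarieties[OF K K'] generated_subvariety_subset_iff)
    have KV: "K \<subseteq> V" "K' \<subseteq> V"
      using K(2) K'(2) by (auto simp: finite_objects_def)
    have "X \<in> ?Var K \<or> X \<in> ?Var K'"
    proof (cases "\<exists>Y \<in> K \<union> K'. carrier Y \<noteq> {}")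
      case True
      then obtain Y where "Y \<in> K \<union> K'" "subquotient S X Y"
        using rhodes_prime_subquotient_of_generator[OF inf V prime _ _ X_KK'] K K' by blast
      then show ?thesis
        using subquotient_in_generated_subvariety[OF V] KV X(1) by blast
    next
      case False
      \<comment> \<open>Empty algebras satisfy every identity, since they admit no valuations.\<close>
      then have "satisfies S Y (t, s)" if "Y \<in> K \<union> K'"
        for Y and t s :: "('f, 'i, 'i + nat) trm"
        using that by (auto simp: satisfies_def)
      then have "X \<in> ?Var K"
        using X_KK' KV by (simp add: mem_generated_subvariety_iff[OF V])
      then show ?thesis ..
    qed
    then show ?thesis
      by (simp add: generated_subvariety_subset_iff)
  qed
  moreover have "?Var {X} \<in> carrier ?L"
    using X(2) by (auto simp: finitely_generated_subvarieties_def)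
  ultimately show ?thesis
    unfolding join_prime_def by (auto simp: finitely_generated_subvarieties_def)
qed

lemma rhodes_primeI:
  assumes V: "variety S V" and X: "X \<in> finite_objects V"
    and ii: "\<And>Y0 Y1. Y0 \<in> finite_objects V \<Longrightarrow> Y1 \<in> finite_objects V \<Longrightarrow>
      carrier Y0 \<noteq> {} \<Longrightarrow> carrier Y1 \<noteq> {} \<Longrightarrow> X \<in> generated_subvariety S V {Y0, Y1} \<Longrightarrow>
      subquotient S X Y0 \<or> subquotient S X Y1"
  shows "rhodes_prime S V X"
proof -
  have X_alg: "is_alg S X"
    using X V by (auto simp: finite_objects_def variety_is_alg)
  have "subquotient S X Y0 \<or> subquotient S X Y1"
    if Y: "Y0 \<in> finite_objects V" "Y1 \<in> finite_objects V"
      and le: "subquotient S X (alg_prod S Y0 Y1)" for Y0 Y1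
  proof (cases "carrier Y0 = {} \<or> carrier Y1 = {}")
    case True
    then have "carrier (alg_prod S Y0 Y1) = {}"
      by (auto simp: alg_prod_def)
    then have "carrier X = {}"
      using le by (auto simp: subquotient_iff[OF X_alg] subalgebra_def)
    then show ?thesis
      using empty_subquotient[OF X_alg] by blast
  next
    case False
    have "X \<in> generated_subvariety S V {Y0, Y1}"
      using variety_subquotient_prod[OF _ _ _ X_alg le]
      by (auto simp: generated_subvariety_def subvariety_def)
    then show ?thesis
      using ii[OF Y] False by blast
  qed
  then show ?thesis
    using X unfolding rhodes_prime_def by blast
qed

theorem proposition7p1:
  fixes S :: "('f, 'i) signature"
    and V :: "('u, 'f, 'i) ualg set"
    and X :: "('u, 'f, 'i) ualg"
  assumes "infinite (UNIV :: 'u set)"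
    and "variety S V"
    and "X \<in> finite_objects V"
  shows "(rhodes_prime S V X \<longleftrightarrow>
            (\<forall>Y0 \<in> finite_objects V. \<forall>Y1 \<in> finite_objects V.
               carrier Y0 \<noteq> {} \<and> carrier Y1 \<noteq> {} \<and> X \<in> generated_subvariety S V {Y0, Y1} \<longrightarrow>
               subquotient S X Y0 \<or> subquotient S X Y1))
       \<and> (rhodes_prime S V X \<longleftrightarrow>
            join_prime (finitely_generated_subvarieties S V) (generated_subvariety S V {X}) \<and>
            (\<forall>Y \<in> finite_objects V.
               carrier Y \<noteq> {} \<and> generated_subvariety S V {X} \<subseteq> generated_subvariety S V {Y} \<longrightarrow>
               subquotient S X Y))"
proof -
  let ?Var = "generated_subvariety S V" and ?L = "finitely_generated_subvarieties S V"
  let ?ii = "\<forall>Y0 \<in> finite_objects V. \<forall>Y1 \<in> finite_objects V.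
    carrier Y0 \<noteq> {} \<and> carrier Y1 \<noteq> {} \<and> X \<in> ?Var {Y0, Y1} \<longrightarrow>
    subquotient S X Y0 \<or> subquotient S X Y1"
  let ?iii = "join_prime ?L (?Var {X}) \<and>
    (\<forall>Y \<in> finite_objects V. carrier Y \<noteq> {} \<and> ?Var {X} \<subseteq> ?Var {Y} \<longrightarrow> subquotient S X Y)"
  have i_ii: ?ii if "rhodes_prime S V X"
    using rhodes_prime_subquotient_of_generator[OF assms(1,2) that, of "{_, _}"] by simp
  have ii_i: "rhodes_prime S V X" if ?ii
    using rhodes_primeI[OF assms(2,3)] that by blast
  have i_iii: ?iii if "rhodes_prime S V X"
    using rhodes_prime_imp_join_prime[OF assms(1,2) that]
      rhodes_prime_subquotient_of_generator[OF assms(1,2) that, of "{_}"]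
    by (simp add: generated_subvariety_subset_iff)
  have iii_ii: ?ii if iii: ?iii
  proof (intro ballI impI)
    fix Y0 Y1
    assume Y: "Y0 \<in> finite_objects V" "Y1 \<in> finite_objects V"
      and *: "carrier Y0 \<noteq> {} \<and> carrier Y1 \<noteq> {} \<and> X \<in> ?Var {Y0, Y1}"
    have in_L: "?Var {Y} \<in> carrier ?L" if "Y \<in> finite_objects V" for Y
      using that by (auto simp: finitely_generated_subvarieties_def)
    have "?Var {X} \<subseteq> ?Var {Y0} \<squnion>\<^bsub>?L\<^esub> ?Var {Y1}"
      using * Y join_generated_subvarieties[of "{Y0}" V "{Y1}" S]
      by (simp add: generated_subvariety_subset_iff insert_commute)
    moreover have "join_prime ?L (?Var {X})"
      using iii by blast
    ultimately have "?Var {X} \<subseteq> ?Var {Y0} \<or> ?Var {X} \<subseteq> ?Var {Y1}"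
      using in_L[OF Y(1)] in_L[OF Y(2)]
      by (simp add: join_prime_def finitely_generated_subvarieties_def)
    then show "subquotient S X Y0 \<or> subquotient S X Y1"
      using iii Y * by blast
  qed
  show ?thesis
    using i_ii ii_i i_iii iii_ii by blast
qed

end
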